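(* Let $F_2=\langle a,b,c\mid abc=1\rangle$ and let $\rho:F_2\to\mathrm{PU}(2,1)$ be a parabolic representation, with $A=\rho(a)$, $B=\rho(b)$, whose fixed points $p_A,p_B,p_{AB},p_{BA}$ (of $A$, $B$, $AB$, $BA$ respectively) are pairwise distinct. Then the fixed point tetrahedron $\tau_\rho=(p_A,p_B,p_{AB},p_{BA})$ is balanced.
   Context: $\langle\cdot,\cdot\rangle$ is a Hermitian form of signature $(2,1)$ on $\mathbb{C}^3$; $\mathbf{H}^2_{\mathbb{C}}$ (resp. $\partial\mathbf{H}^2_{\mathbb{C}}$) is the set of complex lines spanned by negative (resp. non-zero null) vectors, and $\mathrm{PU}(2,1)$ is the holomorphic isometry group of $\mathbf{H}^2_{\mathbb{C}}$. A parabolic isometry is one with exactly one fixed point in $\mathbf{H}^2_{\mathbb{C}}\cup\partial\mathbf{H}^2_{\mathbb{C}}$, lying on $\partial\mathbf{H}^2_{\mathbb{C}}$. A representation $\rho:F_2\to\mathrm{PU}(2,1)$ is called parabolic if it maps $a$, $b$ and $c$ (thus also $ab$ and $ba$) to parabolic isometries. An ideal tetrahedron is an ordered $4$-tuple $(p_1,p_2,p_3,p_4)$ of points of $\partial\mathbf{H}^2_{\mathbb{C}}$. It is balanced if $p_3$ and $p_4$ have the same image under the orthogonal projection $\pi_{12}$ onto the real geodesic $\gamma_{12}$ with endpoints $p_1,p_2$. Explicitly, choosing lifts with $\langle\mathbf{p}_1,\mathbf{p}_2\rangle=-1$, the projection of a point $z\neq p_1,p_2$ of $\mathbf{H}^2_{\mathbb{C}}\cup\partial\mathbf{H}^2_{\mathbb{C}}$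 (with lift $\mathbf{z}$) is the point represented by $$\sqrt{\frac{|\langle\mathbf{z},\mathbf{p}_2\rangle|}{|\langle\mathbf{z},\mathbf{p}_1\rangle|}}\,\mathbf{p}_1+\sqrt{\frac{|\langle\mathbf{z},\mathbf{p}_1\rangle|}{|\langle\mathbf{z},\mathbf{p}_2\rangle|}}\,\mathbf{p}_2 .$$ *)

theory Defs
  imports "HOL-Analysis.Analysis" "HOL-Algebra.Coset"
begin

section \<open>Groups given by generators and relators\<close>

text \<open>The letter \<open>(x, True)\<close> stands for the generator \<open>x\<close> and \<open>(x, False)\<close> for its inverse.\<close>

type_synonym 'g word = "('g \<times> bool) list"

inductive word_eq :: "'g word set \<Rightarrow> 'g word \<Rightarrow> 'g word \<Rightarrow> bool" for R where
  refl: "word_eq R w w"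
| sym: "word_eq R v w \<Longrightarrow> word_eq R w v"
| trans: "word_eq R u v \<Longrightarrow> word_eq R v w \<Longrightarrow> word_eq R u w"
| cancel: "word_eq R (u @ [(x, s), (x, \<not> s)] @ v) (u @ v)"
| relator: "r \<in> R \<Longrightarrow> word_eq R (u @ r @ v) (u @ v)"

definition word_rel :: "'g word set \<Rightarrow> ('g word \<times> 'g word) set" where
  "word_rel R = {(v, w). word_eq R v w}"

definition presented_group :: "'g word set \<Rightarrow> 'g word set monoid" where
  "presented_group R =
     \<lparr>carrier = UNIV // word_rel R,
      mult = (\<lambda>X Y. \<Union>x\<in>X. \<Union>y\<in>Y. word_rel R `` {x @ y}),
      one = word_rel R `` {[]}\<rparr>"

definition generator :: "'g word set \<Rightarrow> 'g \<Rightarrow> 'g word set" where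
  "generator R x = word_rel R `` {[(x, True)]}"

datatype gen = Gen_a | Gen_b | Gen_c

definition F2_relators :: "gen word set" where
  "F2_relators = {[(Gen_a, True), (Gen_b, True), (Gen_c, True)]}"

definition F2 :: "gen word set monoid" where
  "F2 = presented_group F2_relators"

definition F2_a :: "gen word set" where "F2_a = generator F2_relators Gen_a"
definition F2_b :: "gen word set" where "F2_b = generator F2_relators Gen_b"
definition F2_c :: "gen word set" where "F2_c = generator F2_relators Gen_c"

lemma equiv_word_rel: "equiv UNIV (word_rel R)"
  by (rule equivI)
     (auto simp: word_rel_def refl_on_def sym_def trans_def
        intro: word_eq.refl word_eq.sym word_eq.trans)

lemma word_eq_append_left: "word_eq R v w \<Longrightarrow> word_eq R (u @ v) (u @ w)"
proof (induction rule: word_eq.induct)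
  case (cancel u' x s v')
  show ?case using word_eq.cancel[of R "u @ u'" x s v'] by simp
next
  case (relator r u' v')
  then show ?case using word_eq.relator[of r R "u @ u'" v'] by simp
qed (auto intro: word_eq.refl word_eq.sym word_eq.trans)

lemma word_eq_append_right: "word_eq R v w \<Longrightarrow> word_eq R (v @ u) (w @ u)"
proof (induction rule: word_eq.induct)
  case (cancel u' x s v')
  show ?case using word_eq.cancel[of R u' x s "v' @ u"] by simp
next
  case (relator r u' v')
  then show ?case using word_eq.relator[of r R u' "v' @ u"] by simp
qed (auto intro: word_eq.refl word_eq.sym word_eq.trans)

lemma word_eq_append: "word_eq R v w \<Longrightarrow> word_eq R v' w' \<Longrightarrow> word_eq R (v @ v') (w @ w')"
  by (meson word_eq.trans word_eq_append_left word_eq_append_right)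

lemma word_class_eq_iff: "word_rel R `` {v} = word_rel R `` {w} \<longleftrightarrow> word_eq R v w"
  unfolding eq_equiv_class_iff[OF equiv_word_rel UNIV_I UNIV_I] by (simp add: word_rel_def)

lemma presented_group_mult:
  "word_rel R `` {v} \<otimes>\<^bsub>presented_group R\<^esub> word_rel R `` {w} = word_rel R `` {v @ w}"
proof -
  have "word_rel R `` {x @ y} = word_rel R `` {v @ w}"
    if "x \<in> word_rel R `` {v}" "y \<in> word_rel R `` {w}" for x y
    unfolding word_class_eq_iff using that
    by (auto simp: word_rel_def intro: word_eq_append word_eq.sym)
  moreover have "v \<in> word_rel R `` {v}" "w \<in> word_rel R `` {w}"
    by (auto simp: word_rel_def word_eq.refl)
  ultimately have "(\<Union>x\<in>word_rel R `` {v}. \<Union>y\<in>word_rel R `` {w}. word_rel R `` {x @ y})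
      = word_rel R `` {v @ w}"
    by blast
  then show ?thesis
    by (simp add: presented_group_def)
qed

lemma word_eq_inverse: "word_eq R (map (\<lambda>(x, s). (x, \<not> s)) (rev w) @ w) []"
proof (induction w)
  case Nil
  show ?case by (simp add: word_eq.refl)
next
  case (Cons l w)
  obtain x s where l: "l = (x, s)" by fastforce
  have "word_eq R (map (\<lambda>(x, s). (x, \<not> s)) (rev w) @ [(x, \<not> s), (x, \<not> \<not> s)] @ w)
          (map (\<lambda>(x, s). (x, \<not> s)) (rev w) @ w)"
    by (rule word_eq.cancel)
  then show ?case
    using Cons.IH l by (auto intro: word_eq.trans)
qed

lemma group_presented_group: "group (presented_group R)"
proof (rule groupI)
  show "\<one>\<^bsub>presented_group R\<^esub> \<in> carrier (presented_group R)"
    by (auto simp: presented_group_def quotient_def)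
next
  fix X Y
  assume "X \<in> carrier (presented_group R)" "Y \<in> carrier (presented_group R)"
  then obtain v w where "X = word_rel R `` {v}" "Y = word_rel R `` {w}"
    by (auto simp: presented_group_def elim!: quotientE)
  then show "X \<otimes>\<^bsub>presented_group R\<^esub> Y \<in> carrier (presented_group R)"
    by (simp add: presented_group_mult) (auto simp: presented_group_def quotient_def)
next
  fix X Y Z
  assume "X \<in> carrier (presented_group R)" "Y \<in> carrier (presented_group R)"
    "Z \<in> carrier (presented_group R)"
  then obtain u v w where
    "X = word_rel R `` {u}" "Y = word_rel R `` {v}" "Z = word_rel R `` {w}"
    by (auto simp: presented_group_def elim!: quotientE)
  then show "X \<otimes>\<^bsub>presented_group R\<^esub> Y \<otimes>\<^bsub>presented_group R\<^esub> Z
      = X \<otimes>\<^bsub>presented_group R\<^esub> (Y \<otimes>\<^bsub>presented_group R\<^esub> Z)"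
    by (simp add: presented_group_mult)
next
  fix X
  assume "X \<in> carrier (presented_group R)"
  then obtain w where X: "X = word_rel R `` {w}"
    by (auto simp: presented_group_def elim!: quotientE)
  have one: "\<one>\<^bsub>presented_group R\<^esub> = word_rel R `` {[]}"
    by (simp add: presented_group_def)
  show "\<one>\<^bsub>presented_group R\<^esub> \<otimes>\<^bsub>presented_group R\<^esub> X = X"
    by (simp add: X one presented_group_mult)
  let ?Y = "word_rel R `` {map (\<lambda>(x, s). (x, \<not> s)) (rev w)}"
  have "?Y \<in> carrier (presented_group R)"
    by (auto simp: presented_group_def quotient_def)
  moreover have "?Y \<otimes>\<^bsub>presented_group R\<^esub> X = \<one>\<^bsub>presented_group R\<^esub>"
    unfolding X one presented_group_mult word_class_eq_iff by (rule word_eq_inverse)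
  ultimately show "\<exists>Y\<in>carrier (presented_group R). Y \<otimes>\<^bsub>presented_group R\<^esub> X = \<one>\<^bsub>presented_group R\<^esub>"
    by blast
qed

lemma group_F2: "group F2"
  by (simp add: F2_def group_presented_group)

lemma F2_carrier: "F2_a \<in> carrier F2" "F2_b \<in> carrier F2" "F2_c \<in> carrier F2"
  by (auto simp: F2_def F2_a_def F2_b_def F2_c_def generator_def presented_group_def quotient_def)

lemma F2_abc: "F2_a \<otimes>\<^bsub>F2\<^esub> F2_b \<otimes>\<^bsub>F2\<^esub> F2_c = \<one>\<^bsub>F2\<^esub>"
proof -
  have "word_eq F2_relators ([] @ [(Gen_a, True), (Gen_b, True), (Gen_c, True)] @ []) ([] @ [])"
    by (rule word_eq.relator) (simp add: F2_relators_def)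
  then have "word_rel F2_relators `` {[(Gen_a, True), (Gen_b, True), (Gen_c, True)]}
      = word_rel F2_relators `` {[]}"
    by (simp add: word_class_eq_iff)
  then show ?thesis
    unfolding F2_def F2_a_def F2_b_def F2_c_def generator_def presented_group_mult
    by (simp add: presented_group_def)
qed


section \<open>Hermitian forms and the complex hyperbolic plane\<close>

definition hermitian_form :: "(complex^'n \<Rightarrow> complex^'n \<Rightarrow> complex) \<Rightarrow> bool" where
  "hermitian_form h \<longleftrightarrow>
     (\<forall>x y z. h (x + y) z = h x z + h y z) \<and>
     (\<forall>c x y. h (c *s x) y = c * h x y) \<and>
     (\<forall>x y. h y x = cnj (h x y))"

definition has_signature :: "(complex^'n \<Rightarrow> complex^'n \<Rightarrow> complex) \<Rightarrow> nat \<Rightarrow> nat \<Rightarrow> bool" where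
  "has_signature h p q \<longleftrightarrow>
     (\<exists>E. vec.independent E \<and> vec.span E = UNIV \<and>
        (\<forall>u\<in>E. \<forall>v\<in>E. u \<noteq> v \<longrightarrow> h u v = 0) \<and>
        card {e\<in>E. Re (h e e) > 0} = p \<and> card {e\<in>E. Re (h e e) < 0} = q)"

text \<open>For a Hermitian form \<open>h v v\<close> is real, so its sign is that of its real part.\<close>

definition complex_hyperbolic_plane :: "(complex^3 \<Rightarrow> complex^3 \<Rightarrow> complex) \<Rightarrow> (complex^3) set set" where
  "complex_hyperbolic_plane h = {vec.span {v} |v. Re (h v v) < 0}"

definition boundary_hyperbolic_plane :: "(complex^3 \<Rightarrow> complex^3 \<Rightarrow> complex) \<Rightarrow> (complex^3) set set" where
  "boundary_hyperbolic_plane h = {vec.span {v} |v. v \<noteq> 0 \<and> h v v = 0}"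


section \<open>The projective unitary group and its action\<close>

definition unitary_group :: "(complex^'n \<Rightarrow> complex^'n \<Rightarrow> complex) \<Rightarrow> (complex^'n^'n) monoid" where
  "unitary_group h =
     \<lparr>carrier = {M. invertible M \<and> (\<forall>u v. h (M *v u) (M *v v) = h u v)},
      mult = (**), one = mat 1\<rparr>"

definition unitary_scalars :: "(complex^'n^'n) set" where
  "unitary_scalars = {mat c |c. cmod c = 1}"

definition PU :: "(complex^'n \<Rightarrow> complex^'n \<Rightarrow> complex) \<Rightarrow> (complex^'n^'n) set monoid" where
  "PU h = unitary_group h Mod unitary_scalars"

text \<open>An element of \<open>PU h\<close> is a coset of matrices; all of them map a given line to the same
  line, which is therefore the union of the images (see \<open>line_action_coset\<close>).\<close>

definition line_action :: "(complex^'n^'n) set \<Rightarrow> (complex^'n) set \<Rightarrow> (complex^'n) set" where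
  "line_action g L = (\<Union>M\<in>g. (*v) M ` L)"

definition fixed_points ::
    "(complex^3 \<Rightarrow> complex^3 \<Rightarrow> complex) \<Rightarrow> (complex^3^3) set \<Rightarrow> (complex^3) set set" where
  "fixed_points h g =
     {L \<in> complex_hyperbolic_plane h \<union> boundary_hyperbolic_plane h. line_action g L = L}"

definition parabolic :: "(complex^3 \<Rightarrow> complex^3 \<Rightarrow> complex) \<Rightarrow> (complex^3^3) set \<Rightarrow> bool" where
  "parabolic h g \<longleftrightarrow>
     g \<in> carrier (PU h) \<and> (\<exists>p\<in>boundary_hyperbolic_plane h. fixed_points h g = {p})"

definition the_fixed_point ::
    "(complex^3 \<Rightarrow> complex^3 \<Rightarrow> complex) \<Rightarrow> (complex^3^3) set \<Rightarrow> (complex^3) set" where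
  "the_fixed_point h g = (THE p. p \<in> fixed_points h g)"

lemma the_fixed_point_parabolic:
  assumes "parabolic h g"
  shows "fixed_points h g = {the_fixed_point h g}"
    and "the_fixed_point h g \<in> boundary_hyperbolic_plane h"
  using assms unfolding parabolic_def the_fixed_point_def by auto

definition parabolic_representation ::
    "(complex^3 \<Rightarrow> complex^3 \<Rightarrow> complex) \<Rightarrow> (gen word set \<Rightarrow> (complex^3^3) set) \<Rightarrow> bool" where
  "parabolic_representation h \<rho> \<longleftrightarrow>
     \<rho> \<in> hom F2 (PU h) \<and>
     parabolic h (\<rho> F2_a) \<and> parabolic h (\<rho> F2_b) \<and> parabolic h (\<rho> F2_c)"

lemma hermitian_form_scale:
  assumes "hermitian_form h"
  shows "h (c *s x) y = c * h x y" "h x (c *s y) = cnj c * h x y"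
  using assms unfolding hermitian_form_def by (metis, metis complex_cnj_mult)

lemma hermitian_form_add:
  assumes "hermitian_form h"
  shows "h (x + y) z = h x z + h y z" "h x (y + z) = h x y + h x z"
  using assms unfolding hermitian_form_def by (metis, metis complex_cnj_add)

lemma mat_mult_vec: "mat c *v x = c *s (x :: complex^'n)"
  by (simp add: matrix_vector_mult_def mat_def vec_eq_iff if_distrib if_distribR sum.If_cases
      cong: if_cong)

lemma mat_commute: "mat c ** M = M ** (mat c :: complex^'n^'n)"
  by (simp add: matrix_eq matrix_vector_mul_assoc[symmetric] mat_mult_vec vec.scale)

lemma mat_mult_mat: "mat c ** mat d = (mat (c * d) :: complex^'n^'n)"
  by (simp add: matrix_eq matrix_vector_mul_assoc[symmetric] mat_mult_vec)

lemma group_unitary_group: "group (unitary_group h)"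
proof (rule groupI, goal_cases)
  case (1 M N)
  then show ?case
    by (simp add: unitary_group_def invertible_mult matrix_vector_mul_assoc[symmetric])
next
  case 2
  have "invertible (mat 1 :: complex^'a^'a)"
    unfolding invertible_def by (metis matrix_mul_lid)
  then show ?case by (simp add: unitary_group_def)
next
  case (3 M N P)
  then show ?case by (simp add: unitary_group_def matrix_mul_assoc)
next
  case (4 M)
  then show ?case by (simp add: unitary_group_def)
next
  case (5 M)
  then have M: "invertible M" "\<And>u v. h (M *v u) (M *v v) = h u v"
    by (auto simp: unitary_group_def)
  then obtain N where N: "M ** N = mat 1" "N ** M = mat 1"
    by (auto simp: invertible_def)
  have "h (N *v u) (N *v v) = h u v" for u v
    using M(2)[of "N *v u" "N *v v"] N by (simp add: matrix_vector_mul_assoc)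
  with N show ?case by (auto simp: unitary_group_def invertible_def)
qed

lemma normal_unitary_scalars:
  fixes h :: "complex^'n \<Rightarrow> complex^'n \<Rightarrow> complex"
  assumes "hermitian_form h"
  shows "unitary_scalars \<lhd> unitary_group h"
proof -
  interpret U: group "unitary_group h" by (rule group_unitary_group)
  have unit: "c * cnj c = 1" if "cmod c = 1" for c
    using complex_norm_square[of c] that by simp
  have mem: "mat c \<in> carrier (unitary_group h)" if "cmod c = 1" for c
  proof -
    have "mat c ** mat (cnj c) = (mat 1 :: complex^'n^'n)" "mat (cnj c) ** mat c = (mat 1 :: complex^'n^'n)"
      using unit[OF that] by (simp_all add: mat_mult_mat mult.commute)
    then have "invertible (mat c :: complex^'n^'n)" by (auto simp: invertible_def)
    moreover have "h (c *s u) (c *s v) = h u v" for u v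
    proof -
      have "h (c *s u) (c *s v) = (c * cnj c) * h u v"
        unfolding hermitian_form_scale[OF assms] by (simp only: mult.left_commute mult.assoc)
      then show ?thesis using unit[OF that] by simp
    qed
    ultimately show ?thesis by (simp add: unitary_group_def mat_mult_vec)
  qed
  show ?thesis
  proof (rule U.normalI)
    show "subgroup unitary_scalars (unitary_group h)"
    proof (rule U.subgroupI)
      show "unitary_scalars \<subseteq> carrier (unitary_group h)"
        using mem by (auto simp: unitary_scalars_def)
      show "unitary_scalars \<noteq> ({} :: (complex^'n^'n) set)"
        by (auto simp: unitary_scalars_def intro: exI[of _ 1])
    next
      fix M :: "complex^'n^'n" assume "M \<in> unitary_scalars"
      then obtain c where c: "M = mat c" "cmod c = 1" by (auto simp: unitary_scalars_def)
      have "inv\<^bsub>unitary_group h\<^esub> M = mat (cnj c)"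
        by (rule U.inv_equality)
           (use c mem unit in \<open>auto simp: unitary_group_def mat_mult_mat mult.commute\<close>)
      then show "inv\<^bsub>unitary_group h\<^esub> M \<in> unitary_scalars"
        using c by (auto simp: unitary_scalars_def)
    next
      fix M N :: "complex^'n^'n" assume "M \<in> unitary_scalars" "N \<in> unitary_scalars"
      then show "M \<otimes>\<^bsub>unitary_group h\<^esub> N \<in> unitary_scalars"
        by (auto simp: unitary_scalars_def unitary_group_def mat_mult_mat)
           (metis norm_mult mult_1)
    qed
    show "\<forall>x\<in>carrier (unitary_group h).
        unitary_scalars #>\<^bsub>unitary_group h\<^esub> x = x <#\<^bsub>unitary_group h\<^esub> unitary_scalars"
      by (auto simp: r_coset_def l_coset_def unitary_scalars_def unitary_group_def mat_commute)
  qed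
qed

lemma group_PU: "hermitian_form h \<Longrightarrow> group (PU h)"
  unfolding PU_def by (rule normal.factorgroup_is_group[OF normal_unitary_scalars])

lemma line_action_coset:
  "line_action (unitary_scalars #>\<^bsub>unitary_group h\<^esub> M) (vec.span {v}) = vec.span {M *v v}"
proof -
  have eq: "(*v) (mat c ** M) ` vec.span {v} = vec.span {M *v v}" if "cmod c = 1" for c
  proof -
    have "c \<noteq> 0" using that by auto
    have "(mat c ** M) *v (k *s v) = (c * k) *s (M *v v)" for k
      by (simp add: matrix_vector_mul_assoc[symmetric] mat_mult_vec vec.scale)
    then have "(*v) (mat c ** M) ` vec.span {v} = range (\<lambda>k. (c * k) *s (M *v v))"
      by (simp add: vec.span_singleton image_image)
    also have "\<dots> = (\<lambda>k. k *s (M *v v)) ` range ((*) c)"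
      by (simp add: image_image)
    also have "range ((*) c) = UNIV"
    proof -
      have "k = c * (k / c)" for k using \<open>c \<noteq> 0\<close> by simp
      then show ?thesis by blast
    qed
    finally show ?thesis by (simp add: vec.span_singleton)
  qed
  have "line_action (unitary_scalars #>\<^bsub>unitary_group h\<^esub> M) (vec.span {v})
      = (\<Union>c\<in>{c. cmod c = 1}. (*v) (mat c ** M) ` vec.span {v})"
    by (auto simp: line_action_def r_coset_def unitary_scalars_def unitary_group_def)
  also have "\<dots> = (\<Union>c\<in>{c::complex. cmod c = 1}. vec.span {M *v v})"
    using eq by simp
  also have "\<dots> = vec.span {M *v v}"
    using norm_one[where 'a=complex] by blast
  finally show ?thesis .
qed


section \<open>Ideal tetrahedra\<close>

type_synonym tetrahedron =
  "(complex^3) set \<times> (complex^3) set \<times> (complex^3) set \<times> (complex^3) set"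

definition ideal_tetrahedron :: "(complex^3 \<Rightarrow> complex^3 \<Rightarrow> complex) \<Rightarrow> tetrahedron \<Rightarrow> bool" where
  "ideal_tetrahedron h = (\<lambda>(P1, P2, P3, P4). {P1, P2, P3, P4} \<subseteq> boundary_hyperbolic_plane h)"

definition projection_vector ::
    "(complex^3 \<Rightarrow> complex^3 \<Rightarrow> complex) \<Rightarrow> complex^3 \<Rightarrow> complex^3 \<Rightarrow> complex^3 \<Rightarrow> complex^3" where
  "projection_vector h p1 p2 z =
     complex_of_real (sqrt (cmod (h z p2) / cmod (h z p1))) *s p1 +
     complex_of_real (sqrt (cmod (h z p1) / cmod (h z p2))) *s p2"

text \<open>Orthogonal projection onto the real geodesic with endpoints \<open>P1\<close>, \<open>P2\<close>, meant for points
  \<open>Z\<close> of the closed ball other than \<open>P1\<close> and \<open>P2\<close>. The result does not depend on the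
  lifts (see \<open>geodesic_projection_eq\<close>).\<close>

definition geodesic_projection ::
    "(complex^3 \<Rightarrow> complex^3 \<Rightarrow> complex) \<Rightarrow>
     (complex^3) set \<Rightarrow> (complex^3) set \<Rightarrow> (complex^3) set \<Rightarrow> (complex^3) set" where
  "geodesic_projection h P1 P2 Z =
     (THE L. \<exists>p1\<in>P1. \<exists>p2\<in>P2. \<exists>z\<in>Z - {0}.
        h p1 p2 = -1 \<and> L = vec.span {projection_vector h p1 p2 z})"

definition balanced :: "(complex^3 \<Rightarrow> complex^3 \<Rightarrow> complex) \<Rightarrow> tetrahedron \<Rightarrow> bool" where
  "balanced h = (\<lambda>(P1, P2, P3, P4).
     ideal_tetrahedron h (P1, P2, P3, P4) \<and>
     P1 \<noteq> P2 \<and> P3 \<notin> {P1, P2} \<and> P4 \<notin> {P1, P2} \<and>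
     geodesic_projection h P1 P2 P3 = geodesic_projection h P1 P2 P4)"

lemma geodesic_projection_eq:
  assumes h: "hermitian_form h"
    and "P1 = vec.span {v1}" "P2 = vec.span {v2}" "Z = vec.span {w}"
    and p: "p1 \<in> P1" "p2 \<in> P2" "z \<in> Z" "z \<noteq> 0" "h p1 p2 = -1"
  shows "geodesic_projection h P1 P2 Z = vec.span {projection_vector h p1 p2 z}"
  unfolding geodesic_projection_def
proof (rule the_equality)
  show "\<exists>p1'\<in>P1. \<exists>p2'\<in>P2. \<exists>z'\<in>Z - {0}. h p1' p2' = -1 \<and>
      vec.span {projection_vector h p1 p2 z} = vec.span {projection_vector h p1' p2' z'}"
    using p by blast
next
  fix L
  assume "\<exists>p1'\<in>P1. \<exists>p2'\<in>P2. \<exists>z'\<in>Z - {0}. h p1' p2' = -1 \<and>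
      L = vec.span {projection_vector h p1' p2' z'}"
  then obtain p1' p2' z' where p': "p1' \<in> P1" "p2' \<in> P2" "z' \<in> Z" "z' \<noteq> 0" "h p1' p2' = -1"
    and L: "L = vec.span {projection_vector h p1' p2' z'}" by blast
  have multiple: "\<exists>k. y = k *s x" if "x \<in> vec.span {v}" "y \<in> vec.span {v}" "x \<noteq> 0"
    for x y v :: "complex^3"
  proof -
    from that obtain a b where ab: "x = a *s v" "y = b *s v"
      by (auto simp: vec.span_singleton)
    with that have "y = (b / a) *s x" by auto
    then show ?thesis by blast
  qed
  have zero: "h 0 x = 0" "h x 0 = 0" for x
    using hermitian_form_scale(1)[OF h, of 0 x x] hermitian_form_scale(2)[OF h, of x 0 x]
    by simp_all
  have nz: "p1 \<noteq> 0" "p2 \<noteq> 0" using p zero by auto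
  obtain a where a: "p1' = a *s p1" using multiple[of p1 v1 p1'] assms(2) p(1) p'(1) nz by blast
  obtain b where b: "p2' = b *s p2" using multiple[of p2 v2 p2'] assms(3) p(2) p'(2) nz by blast
  obtain c where c: "z' = c *s z" using multiple[of z w z'] assms(4) p(3) p'(3) p(4) by blast
  have c0: "c \<noteq> 0" using c p' by auto
  have "h p1' p2' = (a * cnj b) * h p1 p2"
    unfolding a b hermitian_form_scale[OF h] by (simp only: mult.left_commute mult.assoc)
  then have ab: "a * cnj b = 1"
    using p(5) p'(5) by simp
  then have a0: "a \<noteq> 0" and b0: "b \<noteq> 0" by auto
  have "cmod a * cmod b = 1" using arg_cong[OF ab, of cmod] by (simp add: norm_mult)
  then have cb: "cmod b = 1 / cmod a" using a0 by (simp add: field_simps)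
  let ?u = "a / of_real (cmod a)"
  have b_eq: "b = ?u * of_real (cmod b)"
  proof -
    have "b * cnj a = 1" using arg_cong[OF ab, of cnj] by (simp add: mult.commute)
    then have "b = 1 / cnj a" using a0 by (simp add: field_simps)
    also have "\<dots> = a / of_real ((cmod a)\<^sup>2)"
      using a0 unfolding complex_norm_square by simp
    finally show ?thesis unfolding cb by (simp add: power2_eq_square)
  qed
  have hz1: "cmod (h z' p1') = cmod c * cmod a * cmod (h z p1)"
    by (simp add: a c hermitian_form_scale[OF h] norm_mult)
  have hz2: "cmod (h z' p2') = cmod c * cmod b * cmod (h z p2)"
    by (simp add: b c hermitian_form_scale[OF h] norm_mult)
  let ?r = "cmod (h z p2) / cmod (h z p1)" and ?s = "cmod (h z p1) / cmod (h z p2)"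
  have "cmod (h z' p2') / cmod (h z' p1') = ?r / (cmod a)\<^sup>2"
    using c0 a0 by (simp add: hz1 hz2 cb power2_eq_square field_simps)
  then have r: "sqrt (cmod (h z' p2') / cmod (h z' p1')) = sqrt ?r / cmod a"
    by (simp add: real_sqrt_divide real_sqrt_mult)
  have "cmod (h z' p1') / cmod (h z' p2') = ?s * (cmod a)\<^sup>2"
    using c0 a0 by (simp add: hz1 hz2 cb power2_eq_square field_simps)
  then have s: "sqrt (cmod (h z' p1') / cmod (h z' p2')) = sqrt ?s * cmod a"
    by (simp add: real_sqrt_divide real_sqrt_mult)
  have c1: "of_real (sqrt ?r / cmod a) * a = ?u * of_real (sqrt ?r)" by simp
  have c2: "of_real (sqrt ?s * cmod a) * b = ?u * of_real (sqrt ?s)"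
    by (subst b_eq) (use a0 in \<open>simp add: cb\<close>)
  have "projection_vector h p1' p2' z' =
      (of_real (sqrt ?r / cmod a) * a) *s p1 + (of_real (sqrt ?s * cmod a) * b) *s p2"
    unfolding projection_vector_def r s by (simp add: a b)
  also have "\<dots> = ?u *s projection_vector h p1 p2 z"
    unfolding c1 c2 projection_vector_def by (simp add: vec.scale_right_distrib)
  finally have eq: "projection_vector h p1' p2' z' = ?u *s projection_vector h p1 p2 z" .
  have "?u \<noteq> 0" using a0 by simp
  have "vec.span {k *s x} = vec.span {x}" if "k \<noteq> 0" for k and x :: "complex^3"
  proof -
    have "inverse k *s (k *s x) \<in> vec.span {k *s x}"
      by (intro vec.span_scale vec.span_base) simp
    then have "x \<in> vec.span {k *s x}" using that by simp
    moreover have "k *s x \<in> vec.span {x}" by (simp add: vec.span_base vec.span_scale)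
    ultimately show ?thesis by (simp add: vec.span_eq)
  qed
  with \<open>?u \<noteq> 0\<close> show "L = vec.span {projection_vector h p1 p2 z}" by (simp add: L eq)
qed

lemma projection_vector_negative:
  assumes h: "hermitian_form h"
    and p: "h p1 p1 = 0" "h p2 p2 = 0" "h p1 p2 = -1" and z: "h z p1 \<noteq> 0" "h z p2 \<noteq> 0"
  shows "h (projection_vector h p1 p2 z) (projection_vector h p1 p2 z) = -2"
proof -
  let ?s = "sqrt (cmod (h z p2) / cmod (h z p1))" and ?t = "sqrt (cmod (h z p1) / cmod (h z p2))"
  have "h p2 p1 = cnj (h p1 p2)" using h unfolding hermitian_form_def by blast
  then have "h p2 p1 = -1" by (simp add: p)
  then have expand: "h (of_real s *s p1 + of_real t *s p2) (of_real s *s p1 + of_real t *s p2)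
      = of_real (-2 * (s * t))" for s t :: real
    by (simp add: hermitian_form_add[OF h] hermitian_form_scale[OF h] p)
  have "cmod (h z p2) / cmod (h z p1) * (cmod (h z p1) / cmod (h z p2)) = 1"
    using z by simp
  then have st: "?s * ?t = 1"
    by (simp only: real_sqrt_mult[symmetric] real_sqrt_one)
  show ?thesis
    unfolding projection_vector_def expand st by simp
qed

end

theory Submission
  imports Defs
begin

text \<open>
  The whole statement rests on one fact: if \<open>M\<close> is a unitary lift of a parabolic isometry
  and \<open>p\<close> spans its fixed point, then \<open>M p = \<lambda> p\<close> with \<open>\<lambda>\<close> of modulus 1
  (\<open>parabolic_fixed_vector_unit_eigenvalue\<close>). Hence the function
  \<open>u \<mapsto> |\<langle>u, p\<rangle>|\<close> is invariant under \<open>M\<close> (\<open>cmod_form_unit_eigenvector\<close>), which is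
  the vector form of the fact that parabolic isometries preserve the horospheres at their
  fixed point.

  Let \<open>M\<close>, \<open>N\<close> lift \<open>A\<close>, \<open>B\<close>, let \<open>p1\<close>, \<open>p2\<close> span their fixed points, and
  let \<open>p3\<close> span that of \<open>AB\<close>. Since \<open>BA\<close> is the conjugate of \<open>AB\<close> by \<open>B\<close>, its
  fixed point is spanned by \<open>p4 = N p3\<close>; and \<open>M p4 = (M N) p3\<close> is again \<open>p3\<close>
  up to a unit factor, because \<open>AB\<close>, the inverse of \<open>\<rho> c\<close>, is parabolic. So \<open>N\<close> moves
  \<open>p3\<close> to \<open>p4\<close> while preserving \<open>|\<langle>u, p2\<rangle>|\<close>, and \<open>M\<close> moves \<open>p4\<close> back to \<open>p3\<close>
  while preserving \<open>|\<langle>u, p1\<rangle>|\<close>. The projection to the geodesic from \<open>p1\<close> to \<open>p2\<close>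
  depends on \<open>u\<close> only through these two moduli, so it agrees at \<open>p3\<close> and \<open>p4\<close>.

  The signature enters twice: nondegeneracy is needed for the unit eigenvalue, and distinct
  isotropic lines must be non-orthogonal for \<open>p1\<close> and \<open>p2\<close> to have lifts with
  \<open>\<langle>p1, p2\<rangle> = -1\<close>.
\<close>

section \<open>Forms of signature (2,1)\<close>

lemma hermitian_form_cnj: "hermitian_form h \<Longrightarrow> h y x = cnj (h x y)"
  unfolding hermitian_form_def by blast

lemma span_singleton_scale:
  fixes v :: "complex^'n"
  assumes "k \<noteq> 0"
  shows "vec.span {k *s v} = vec.span {v}"
  using vec.span_image_scale[of "{v}" "\<lambda>_. k"] assms by simp

text \<open>The three signs already account for the dimension, so the orthogonal basis has no isotropic
  member.\<close>

lemma signature_2_1_basis: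
  fixes h :: "complex^3 \<Rightarrow> complex^3 \<Rightarrow> complex"
  assumes "has_signature h 2 1"
  obtains e1 e2 e3 where
    "Re (h e1 e1) > 0" "Re (h e2 e2) > 0" "Re (h e3 e3) < 0"
    "\<And>u v. u \<in> {e1, e2, e3} \<Longrightarrow> v \<in> {e1, e2, e3} \<Longrightarrow> u \<noteq> v \<Longrightarrow> h u v = 0"
    "e1 \<noteq> e2" "e1 \<noteq> e3" "e2 \<noteq> e3"
    "\<And>v. \<exists>x y z. v = x *s e1 + y *s e2 + z *s e3"
proof -
  obtain E where E: "vec.independent E" "vec.span E = UNIV"
      and orth: "\<forall>u\<in>E. \<forall>v\<in>E. u \<noteq> v \<longrightarrow> h u v = 0"
      and pos: "card {e\<in>E. Re (h e e) > 0} = 2" and neg: "card {e\<in>E. Re (h e e) < 0} = 1"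
    using assms unfolding has_signature_def by blast
  have fin: "finite E" using E(1) by (rule vec.finiteI_independent)
  have cardE: "card E = 3"
    using vec.dim_eq_card[of E UNIV] E vec_dim_card[where 'a=complex and 'n=3] by simp
  obtain e3 where e3: "{e\<in>E. Re (h e e) < 0} = {e3}" using neg card_1_singletonE by blast
  obtain e1 e2 where e12: "{e\<in>E. Re (h e e) > 0} = {e1, e2}" "e1 \<noteq> e2"
    using pos unfolding card_2_iff by blast
  have mem: "e1 \<in> E" "e2 \<in> E" "e3 \<in> E"
    and sg: "Re (h e1 e1) > 0" "Re (h e2 e2) > 0" "Re (h e3 e3) < 0"
    using e3 e12 by blast+
  have ne: "e1 \<noteq> e3" "e2 \<noteq> e3" using sg by auto
  have "{e1, e2, e3} = E"
    by (rule card_subset_eq[OF fin]) (use mem cardE e12(2) ne in auto)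
  then have "v \<in> vec.span {e1, e2, e3}" for v using E(2) by simp
  then have "\<exists>x y z. v = x *s e1 + y *s e2 + z *s e3" for v
    unfolding vec.span_breakdown_eq vec.span_empty by (auto simp: algebra_simps)
  with that[OF sg _ e12(2) ne] orth mem show thesis by blast
qed

lemma signature_2_1_nondegenerate:
  fixes h :: "complex^3 \<Rightarrow> complex^3 \<Rightarrow> complex"
  assumes h: "hermitian_form h" and sig: "has_signature h 2 1" and "\<And>u. h u v = 0"
  shows "v = 0"
proof -
  obtain e1 e2 e3 where sg: "Re (h e1 e1) > 0" "Re (h e2 e2) > 0" "Re (h e3 e3) < 0"
    and orth: "\<And>u v. u \<in> {e1, e2, e3} \<Longrightarrow> v \<in> {e1, e2, e3} \<Longrightarrow> u \<noteq> v \<Longrightarrow> h u v = 0"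
    and ne: "e1 \<noteq> e2" "e1 \<noteq> e3" "e2 \<noteq> e3"
    and ex: "\<And>v. \<exists>x y z. v = x *s e1 + y *s e2 + z *s e3"
    using signature_2_1_basis[OF sig] by metis
  obtain x y z where v: "v = x *s e1 + y *s e2 + z *s e3" using ex by blast
  have "h e1 v = cnj x * h e1 e1" "h e2 v = cnj y * h e2 e2" "h e3 v = cnj z * h e3 e3"
    using ne ne[symmetric] by (simp_all add: v hermitian_form_add[OF h] hermitian_form_scale[OF h] orth)
  with assms(3) sg have "x = 0" "y = 0" "z = 0" by auto
  then show ?thesis by (simp add: v)
qed

text \<open>If \<open>u\<close> and \<open>v\<close> were independent, they would span a totally isotropic plane. Every
  plane meets the positive definite plane \<open>span {e1, e2}\<close> in a nonzero vector, which cannot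
  be isotropic.\<close>

lemma signature_2_1_orthogonal_null_proportional:
  fixes h :: "complex^3 \<Rightarrow> complex^3 \<Rightarrow> complex"
  assumes h: "hermitian_form h" and sig: "has_signature h 2 1"
    and null: "h u u = 0" "h v v = 0" and uv: "h u v = 0" and "v \<noteq> 0"
  shows "\<exists>k. u = k *s v"
proof -
  obtain e1 e2 e3 where sg: "Re (h e1 e1) > 0" "Re (h e2 e2) > 0" "Re (h e3 e3) < 0"
    and orth: "\<And>u v. u \<in> {e1, e2, e3} \<Longrightarrow> v \<in> {e1, e2, e3} \<Longrightarrow> u \<noteq> v \<Longrightarrow> h u v = 0"
    and ne: "e1 \<noteq> e2" "e1 \<noteq> e3" "e2 \<noteq> e3"
    and ex: "\<And>v. \<exists>x y z. v = x *s e1 + y *s e2 + z *s e3"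
    using signature_2_1_basis[OF sig] by metis
  have definite: "x *s e1 + y *s e2 = 0"
    if "h (x *s e1 + y *s e2) (x *s e1 + y *s e2) = 0" for x y
  proof -
    have "x * cnj x * h e1 e1 + y * cnj y * h e2 e2 = 0"
      using that ne ne[symmetric]
      by (simp add: hermitian_form_add[OF h] hermitian_form_scale[OF h] orth ac_simps)
    then have "of_real ((cmod x)\<^sup>2) * h e1 e1 + of_real ((cmod y)\<^sup>2) * h e2 e2 = 0"
      by (simp only: complex_norm_square)
    from arg_cong[OF this, of Re]
    have "(cmod x)\<^sup>2 * Re (h e1 e1) + (cmod y)\<^sup>2 * Re (h e2 e2) = 0" by simp
    moreover have "(cmod x)\<^sup>2 * Re (h e1 e1) \<ge> 0" "(cmod y)\<^sup>2 * Re (h e2 e2) \<ge> 0"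
      using sg by simp_all
    ultimately have "(cmod x)\<^sup>2 * Re (h e1 e1) = 0" "(cmod y)\<^sup>2 * Re (h e2 e2) = 0" by linarith+
    with sg show ?thesis by simp
  qed
  obtain x y z where u: "u = x *s e1 + y *s e2 + z *s e3" using ex by blast
  obtain x' y' z' where v: "v = x' *s e1 + y' *s e2 + z' *s e3" using ex by blast
  have "z' \<noteq> 0"
    using definite[of x' y'] null(2) \<open>v \<noteq> 0\<close> v by auto
  \<comment> \<open>The combination of \<open>u\<close> and \<open>v\<close> whose \<open>e3\<close>-coordinate cancels.\<close>
  let ?w = "z' *s u - z *s v"
  have w: "?w = (z' * x - z * x') *s e1 + (z' * y - z * y') *s e2"
    by (simp add: u v vec_eq_iff algebra_simps)
  have "h v u = 0" using hermitian_form_cnj[OF h, of v u] uv by simp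
  then have "h (z' *s u + (-z) *s v) (z' *s u + (-z) *s v) = 0"
    using null uv unfolding hermitian_form_add[OF h] hermitian_form_scale[OF h] by simp
  moreover have "z' *s u + (-z) *s v = ?w" by (simp add: vec_eq_iff)
  ultimately have "h ?w ?w = 0" by simp
  then have "?w = 0" using definite unfolding w by blast
  then have "u = (z / z') *s v" using \<open>z' \<noteq> 0\<close> by (simp add: vec_eq_iff field_simps)
  then show ?thesis ..
qed

section \<open>The action on complex lines\<close>

abbreviation coset where "coset h M \<equiv> unitary_scalars #>\<^bsub>unitary_group h\<^esub> M"

lemma PU_lift:
  assumes "g \<in> carrier (PU h)"
  obtains M where "M \<in> carrier (unitary_group h)" "g = coset h M"
  using assms unfolding PU_def FactGroup_def RCOSETS_def by auto

lemma PU_mult_coset: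
  assumes "hermitian_form h" "M \<in> carrier (unitary_group h)" "N \<in> carrier (unitary_group h)"
  shows "coset h M \<otimes>\<^bsub>PU h\<^esub> coset h N = coset h (M ** N)"
  using normal.rcos_sum[OF normal_unitary_scalars[OF assms(1)] assms(2,3)]
  by (simp add: PU_def FactGroup_def unitary_group_def)

lemma unitary_group_nonzero:
  assumes "M \<in> carrier (unitary_group h)" and "v \<noteq> 0"
  shows "M *v v \<noteq> 0"
  using assms invertible_eq_bij[of M]
  by (simp add: unitary_group_def) (metis bij_def inj_eq matrix_vector_mult_0_right)

lemma line_action_mult:
  assumes h: "hermitian_form h" and g: "g \<in> carrier (PU h)" "g' \<in> carrier (PU h)"
  shows "line_action (g \<otimes>\<^bsub>PU h\<^esub> g') (vec.span {v}) = line_action g (line_action g' (vec.span {v}))"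
proof -
  obtain M where M: "M \<in> carrier (unitary_group h)" "g = coset h M" using g(1) by (rule PU_lift)
  obtain N where N: "N \<in> carrier (unitary_group h)" "g' = coset h N" using g(2) by (rule PU_lift)
  show ?thesis
    unfolding M(2) N(2) PU_mult_coset[OF h M(1) N(1)] line_action_coset
    by (simp add: matrix_vector_mul_assoc)
qed

lemma line_action_one:
  assumes "hermitian_form h"
  shows "line_action \<one>\<^bsub>PU h\<^esub> (vec.span {v}) = vec.span {v}"
proof -
  interpret normal "unitary_scalars" "unitary_group h"
    using assms by (rule normal_unitary_scalars)
  have "\<one>\<^bsub>PU h\<^esub> = coset h (mat 1)"
    using coset_join2[OF one_closed subgroup_axioms]
    by (simp add: PU_def FactGroup_def unitary_group_def r_coset_def unitary_scalars_def)
  then show ?thesis by (simp add: line_action_coset)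
qed

lemma fixed_points_inv:
  assumes h: "hermitian_form h" and g: "g \<in> carrier (PU h)"
  shows "fixed_points h (inv\<^bsub>PU h\<^esub> g) = fixed_points h g"
proof -
  interpret P: group "PU h" using h by (rule group_PU)
  have sub: "fixed_points h f \<subseteq> fixed_points h (inv\<^bsub>PU h\<^esub> f)" if f: "f \<in> carrier (PU h)" for f
  proof
    fix L assume L: "L \<in> fixed_points h f"
    then have fixed: "line_action f L = L" by (simp add: fixed_points_def)
    obtain v where v: "L = vec.span {v}" using L
      by (auto simp: fixed_points_def complex_hyperbolic_plane_def boundary_hyperbolic_plane_def)
    have "line_action (inv\<^bsub>PU h\<^esub> f) L = line_action (inv\<^bsub>PU h\<^esub> f) (line_action f L)"
      by (simp add: fixed)
    also have "\<dots> = line_action \<one>\<^bsub>PU h\<^esub> L"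
      using line_action_mult[OF h P.inv_closed[OF f] f] f by (simp add: v)
    also have "\<dots> = L" by (simp add: v line_action_one[OF h])
    finally show "L \<in> fixed_points h (inv\<^bsub>PU h\<^esub> f)" using L by (simp add: fixed_points_def)
  qed
  show ?thesis using sub[OF g] sub[OF P.inv_closed[OF g]] g by simp
qed

lemma line_action_closed_ball:
  assumes g: "g \<in> carrier (PU h)"
  shows "L \<in> complex_hyperbolic_plane h \<Longrightarrow> line_action g L \<in> complex_hyperbolic_plane h"
    and "hermitian_form h \<Longrightarrow> L \<in> boundary_hyperbolic_plane h
      \<Longrightarrow> line_action g L \<in> boundary_hyperbolic_plane h"
proof -
  obtain M where M: "M \<in> carrier (unitary_group h)" "g = coset h M" using g by (rule PU_lift)
  have iso: "h (M *v v) (M *v v) = h v v" for v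
    using M(1) by (simp add: unitary_group_def)
  note nz = unitary_group_nonzero[OF M(1)]
  show "L \<in> complex_hyperbolic_plane h \<Longrightarrow> line_action g L \<in> complex_hyperbolic_plane h"
    using iso by (fastforce simp: complex_hyperbolic_plane_def M(2) line_action_coset)
  show "hermitian_form h \<Longrightarrow> L \<in> boundary_hyperbolic_plane h
      \<Longrightarrow> line_action g L \<in> boundary_hyperbolic_plane h"
    using iso nz by (fastforce simp: boundary_hyperbolic_plane_def M(2) line_action_coset)
qed

text \<open>\<open>g' g\<close> is the conjugate of \<open>g g'\<close> by \<open>g'\<close>, so \<open>g'\<close> carries the fixed points of
  one to those of the other.\<close>

lemma fixed_points_mult_swap:
  assumes h: "hermitian_form h" and g: "g \<in> carrier (PU h)" "g' \<in> carrier (PU h)"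
  shows "fixed_points h (g' \<otimes>\<^bsub>PU h\<^esub> g) = line_action g' ` fixed_points h (g \<otimes>\<^bsub>PU h\<^esub> g')"
proof -
  have image: "line_action f' L \<in> fixed_points h (f' \<otimes>\<^bsub>PU h\<^esub> f)"
      "line_action f (line_action f' L) = L"
    if f: "f \<in> carrier (PU h)" "f' \<in> carrier (PU h)" and L: "L \<in> fixed_points h (f \<otimes>\<^bsub>PU h\<^esub> f')"
    for f f' L
  proof -
    obtain v where v: "L = vec.span {v}" using L
      by (auto simp: fixed_points_def complex_hyperbolic_plane_def boundary_hyperbolic_plane_def)
    show fixed: "line_action f (line_action f' L) = L"
      using L line_action_mult[OF h f, of v] by (simp add: v fixed_points_def)
    obtain M where "f' = coset h M" using f(2) by (rule PU_lift)
    then have "line_action (f' \<otimes>\<^bsub>PU h\<^esub> f) (line_action f' L)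
        = line_action f' (line_action f (line_action f' L))"
      using line_action_mult[OF h f(2,1)] by (simp add: v line_action_coset)
    then show "line_action f' L \<in> fixed_points h (f' \<otimes>\<^bsub>PU h\<^esub> f)"
      using L line_action_closed_ball[OF f(2)] h by (auto simp: fixed_points_def fixed)
  qed
  show ?thesis
    using image[OF g] image[OF g(2,1)] by (auto simp: image_iff) metis
qed

section \<open>Parabolic isometries\<close>

text \<open>If the eigenvalue \<open>l\<close> at the fixed point had modulus other than 1, then \<open>M\<close> would be
  loxodromic and have a second fixed point on the boundary. To find it, observe that
  \<open>u \<mapsto> h u p\<close> is a nonzero left eigenvector of \<open>M\<close> for \<open>m = 1 / cnj l\<close>. So
  \<open>m\<close> is also a right eigenvalue; its eigenvector \<open>q\<close> is isotropic because \<open>cmod m\<close>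
  is not 1, and independent of \<open>p\<close> because \<open>m\<close> and \<open>l\<close> have different moduli.\<close>

lemma parabolic_fixed_vector_unit_eigenvalue:
  assumes h: "hermitian_form h" and sig: "has_signature h 2 1"
    and M: "M \<in> carrier (unitary_group h)" and par: "parabolic h (coset h M)"
    and p: "the_fixed_point h (coset h M) = vec.span {p}" "p \<noteq> 0"
  shows "\<exists>l. cmod l = 1 \<and> M *v p = l *s p"
proof -
  have iso: "h (M *v u) (M *v v) = h u v" for u v using M by (simp add: unitary_group_def)
  have fp: "fixed_points h (coset h M) = {vec.span {p}}"
    using the_fixed_point_parabolic(1)[OF par] by (simp add: p(1))
  then have "vec.span {M *v p} = vec.span {p}"
    unfolding line_action_coset[of h M p, symmetric] by (auto simp: fixed_points_def)
  then have "M *v p \<in> vec.span {p}" using vec.span_base by fastforce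
  then obtain l where l: "M *v p = l *s p" by (auto simp: vec.span_singleton)
  have l0: "l \<noteq> 0" using unitary_group_nonzero[OF M p(2)] l by auto
  have "cmod l = 1"
  proof (rule ccontr)
    assume nl: "cmod l \<noteq> 1"
    define m where "m = 1 / cnj l"
    have cm: "cmod m = 1 / cmod l" by (simp add: m_def norm_divide)
    have adj: "h (M *v u) p = m * h u p" for u
      using iso[of u p] l0 by (simp add: l hermitian_form_scale[OF h] m_def field_simps)
    let ?T = "M - mat m"
    have T: "?T *v u = M *v u - m *s u" for u
      by (simp add: matrix_vector_mult_diff_rdistrib mat_mult_vec)
    have ker: "h (?T *v u) p = 0" for u
    proof -
      have "h (M *v u + (-m) *s u) p = 0"
        unfolding hermitian_form_add[OF h] hermitian_form_scale[OF h] adj by simp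
      moreover have "M *v u + (-m) *s u = ?T *v u" by (simp add: T vec_eq_iff)
      ultimately show ?thesis by simp
    qed
    \<comment> \<open>The range lies in the hyperplane orthogonal to \<open>p\<close>, which is proper by nondegeneracy.\<close>
    have "\<not> surj ((*v) ?T)"
      using ker signature_2_1_nondegenerate[OF h sig, of p] p(2) by (metis surj_def)
    then have "\<not> inj ((*v) ?T)"
      using vec.linear_inj_imp_surj[OF matrix_vector_mul_linear_gen] by blast
    then obtain q where q: "?T *v q = 0" "q \<noteq> 0"
      using matrix_left_invertible_ker[of ?T] matrix_left_invertible_injective[of ?T] by blast
    then have Mq: "M *v q = m *s q" by (simp add: T)
    have "m * cnj m * h q q = h q q"
      using iso[of q q] by (simp add: Mq hermitian_form_scale[OF h] ac_simps)
    moreover have "m * cnj m \<noteq> 1"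
    proof
      assume "m * cnj m = 1"
      then have "(cmod m)\<^sup>2 = 1" by (metis complex_norm_square of_real_eq_1_iff)
      then have "cmod m = 1"
        by (simp add: power2_eq_1_iff) (use norm_ge_zero[of m] in linarith)
      with nl show False by (simp add: cm)
    qed
    ultimately have "h q q = 0" by auto
    then have "vec.span {q} \<in> boundary_hyperbolic_plane h"
      using q(2) by (auto simp: boundary_hyperbolic_plane_def)
    moreover have "m \<noteq> 0" using l0 by (simp add: m_def)
    then have "vec.span {M *v q} = vec.span {q}"
      by (simp add: Mq span_singleton_scale)
    ultimately have "vec.span {q} \<in> fixed_points h (coset h M)"
      by (simp add: fixed_points_def line_action_coset)
    then have "q \<in> vec.span {p}" using fp vec.span_base[of q "{q}"] by auto
    then obtain k where k: "q = k *s p" by (auto simp: vec.span_singleton)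
    have "m *s q = l *s q"
      using l Mq by (auto simp: k vec.scale mult.commute)
    then have "m = l" using q(2) by simp
    with cm l0 have "cmod l * cmod l = 1" by (simp add: field_simps)
    then have "(cmod l)\<^sup>2 = 1" by (simp add: power2_eq_square)
    with nl show False by (simp add: power2_eq_1_iff) (use norm_ge_zero[of l] in linarith)
  qed
  with l show ?thesis by blast
qed

lemma cmod_form_unit_eigenvector:
  assumes h: "hermitian_form h" and M: "M \<in> carrier (unitary_group h)"
    and "M *v v = l *s v" "cmod l = 1"
  shows "cmod (h (M *v u) v) = cmod (h u v)"
proof -
  have "h u v = cnj l * h (M *v u) v"
    using M assms(3) hermitian_form_scale[OF h] by (simp add: unitary_group_def) metis
  then show ?thesis using assms(4) by (simp add: norm_mult)
qed

theorem corollary2p10: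
  fixes h :: "complex^3 \<Rightarrow> complex^3 \<Rightarrow> complex"
    and \<rho> :: "gen word set \<Rightarrow> (complex^3^3) set"
    and A B :: "(complex^3^3) set"
  assumes "hermitian_form h" and "has_signature h 2 1"
    and "parabolic_representation h \<rho>"
    and "A = \<rho> F2_a" and "B = \<rho> F2_b"
    and "distinct [the_fixed_point h A, the_fixed_point h B,
           the_fixed_point h (A \<otimes>\<^bsub>PU h\<^esub> B), the_fixed_point h (B \<otimes>\<^bsub>PU h\<^esub> A)]"
  shows "balanced h (the_fixed_point h A, the_fixed_point h B,
           the_fixed_point h (A \<otimes>\<^bsub>PU h\<^esub> B), the_fixed_point h (B \<otimes>\<^bsub>PU h\<^esub> A))"
proof -
  note h = assms(1) and sig = assms(2) and dist = assms(6)
  interpret P: group "PU h" using h by (rule group_PU)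
  interpret F: group F2 by (rule group_F2)
  let ?C = "\<rho> F2_c"
  have hom: "\<rho> \<in> hom F2 (PU h)" and par: "parabolic h A" "parabolic h B" "parabolic h ?C"
    using assms(3-5) by (auto simp: parabolic_representation_def)
  then have car: "A \<in> carrier (PU h)" "B \<in> carrier (PU h)" "?C \<in> carrier (PU h)"
    by (auto simp: parabolic_def)
  have "A \<otimes>\<^bsub>PU h\<^esub> B \<otimes>\<^bsub>PU h\<^esub> ?C = \<rho> (F2_a \<otimes>\<^bsub>F2\<^esub> F2_b \<otimes>\<^bsub>F2\<^esub> F2_c)"
    using hom F2_carrier by (simp add: assms(4,5) hom_mult)
  also have "\<dots> = \<one>\<^bsub>PU h\<^esub>"
    using hom_one[OF hom group_F2 P.is_group] by (simp add: F2_abc)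
  finally have AB: "A \<otimes>\<^bsub>PU h\<^esub> B = inv\<^bsub>PU h\<^esub> ?C"
    using car P.inv_equality[of "A \<otimes>\<^bsub>PU h\<^esub> B" ?C] by simp
  \<comment> \<open>Parabolicity of \<open>AB\<close> comes from that of its inverse \<open>\<rho> c\<close>, which has the same fixed
    points.\<close>
  have par_AB: "parabolic h (A \<otimes>\<^bsub>PU h\<^esub> B)"
    using par(3) car unfolding AB parabolic_def by (simp add: fixed_points_inv[OF h])

  obtain M where M: "M \<in> carrier (unitary_group h)" "A = coset h M" using car(1) by (rule PU_lift)
  obtain N where N: "N \<in> carrier (unitary_group h)" "B = coset h N" using car(2) by (rule PU_lift)
  have MN: "M ** N \<in> carrier (unitary_group h)" "A \<otimes>\<^bsub>PU h\<^esub> B = coset h (M ** N)"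
    using group.is_monoid[OF group_unitary_group, THEN monoid.m_closed, OF M(1) N(1)]
      PU_mult_coset[OF h M(1) N(1)] M(2) N(2) by (simp_all add: unitary_group_def)

  obtain u1 where u1: "the_fixed_point h A = vec.span {u1}" "u1 \<noteq> 0" "h u1 u1 = 0"
    using the_fixed_point_parabolic(2)[OF par(1)] by (auto simp: boundary_hyperbolic_plane_def)
  obtain u2 where u2: "the_fixed_point h B = vec.span {u2}" "u2 \<noteq> 0" "h u2 u2 = 0"
    using the_fixed_point_parabolic(2)[OF par(2)] by (auto simp: boundary_hyperbolic_plane_def)
  obtain u3 where u3: "the_fixed_point h (A \<otimes>\<^bsub>PU h\<^esub> B) = vec.span {u3}" "u3 \<noteq> 0"
    using the_fixed_point_parabolic(2)[OF par_AB] by (auto simp: boundary_hyperbolic_plane_def)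
  let ?u4 = "N *v u3"

  have N_line: "line_action B (vec.span {u3}) = vec.span {?u4}"
    by (simp add: N(2) line_action_coset)
  have fp_BA: "fixed_points h (B \<otimes>\<^bsub>PU h\<^esub> A) = {vec.span {?u4}}"
    using fixed_points_mult_swap[OF h car(1,2)] the_fixed_point_parabolic(1)[OF par_AB]
    by (simp add: u3 N_line)
  then have u4: "the_fixed_point h (B \<otimes>\<^bsub>PU h\<^esub> A) = vec.span {?u4}"
    by (simp add: the_fixed_point_def)
  have bd4: "vec.span {?u4} \<in> boundary_hyperbolic_plane h"
    using line_action_closed_ball(2)[OF car(2) h the_fixed_point_parabolic(2)[OF par_AB]]
    by (simp add: u3 N_line)

  obtain l1 where l1: "cmod l1 = 1" "M *v u1 = l1 *s u1"
    using parabolic_fixed_vector_unit_eigenvalue[OF h sig M(1)] par(1) u1 M(2) by blast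
  obtain l2 where l2: "cmod l2 = 1" "N *v u2 = l2 *s u2"
    using parabolic_fixed_vector_unit_eigenvalue[OF h sig N(1)] par(2) u2 N(2) by blast
  obtain l3 where l3: "cmod l3 = 1" "M *v ?u4 = l3 *s u3"
    using parabolic_fixed_vector_unit_eigenvalue[OF h sig MN(1), of u3] par_AB u3 MN(2)
    by (auto simp: matrix_vector_mul_assoc)

  have c2: "cmod (h ?u4 u2) = cmod (h u3 u2)"
    by (rule cmod_form_unit_eigenvector[OF h N(1) l2(2,1)])
  have c1: "cmod (h ?u4 u1) = cmod (h u3 u1)"
    using cmod_form_unit_eigenvector[OF h M(1) l1(2,1), of ?u4] l3
    by (simp add: hermitian_form_scale[OF h] norm_mult)

  have "h u1 u2 \<noteq> 0"
  proof
    assume "h u1 u2 = 0"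
    then obtain k where k: "u1 = k *s u2"
      using signature_2_1_orthogonal_null_proportional[OF h sig u1(3) u2(3) _ u2(2)] by blast
    with u1(2) have "k \<noteq> 0" by auto
    then have "vec.span {u1} = vec.span {u2}"
      by (simp add: k span_singleton_scale)
    with dist u1(1) u2(1) show False by simp
  qed
  define p1 where "p1 = (- 1 / h u1 u2) *s u1"
  have p12: "h p1 u2 = -1"
    using \<open>h u1 u2 \<noteq> 0\<close> unfolding p1_def hermitian_form_scale[OF h] by simp
  have p1: "p1 \<in> vec.span {u1}" unfolding p1_def by (intro vec.span_scale vec.span_base) simp
  have "cmod (h ?u4 p1) = cmod (h u3 p1)"
    using c1 unfolding p1_def hermitian_form_scale[OF h] by (simp add: norm_mult norm_divide)
  with c2 have pv: "projection_vector h p1 u2 u3 = projection_vector h p1 u2 ?u4"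
    by (simp add: projection_vector_def)
  have "geodesic_projection h (vec.span {u1}) (vec.span {u2}) (vec.span {z})
      = vec.span {projection_vector h p1 u2 z}" if "z \<noteq> 0" for z
    using that p1 p12 by (intro geodesic_projection_eq[OF h]) (auto simp: vec.span_base)
  from this[OF u3(2)] this[OF unitary_group_nonzero[OF N(1) u3(2)]]
  have "geodesic_projection h (vec.span {u1}) (vec.span {u2}) (vec.span {u3})
      = geodesic_projection h (vec.span {u1}) (vec.span {u2}) (vec.span {?u4})"
    by (simp add: pv)
  then show ?thesis
    using dist bd4 the_fixed_point_parabolic(2)[OF par(1)] the_fixed_point_parabolic(2)[OF par(2)]
      the_fixed_point_parabolic(2)[OF par_AB]
    unfolding balanced_def ideal_tetrahedron_def u1(1) u2(1) u3(1) u4 by auto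
qed

end
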